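(* Let $g:\mathbb{R}^n\to\mathbb{R}$ be a continuous piecewise linear function and let $0<c_1<c_2<1$. Suppose that the BFGS method with the Armijo--Wolfe line search with parameters $c_1,c_2$, applied to $g$ with some starting point $x_0\in\mathbb{R}^n$ and some symmetric positive definite initial inverse Hessian approximation $H_0$, generates an infinite sequence of iterates $\{x_k\}$ such that $g$ is differentiable at every $x_k$, and that $\{x_k\}$ converges to a point $x^*$ at which $g$ is not differentiable and at which only two linear pieces of $g$ intersect. Then $x^*$ is a local minimizer of $g$.
   Context: Piecewise linear means that $\mathbb{R}^n$ is a finite union of polyhedra on each of which $g$ is affine. "Only two linear pieces intersect at $x^*$" means that there are a neighborhood $U$ of $x^*$ and two distinct affine functions $\ell_1,\ell_2$ such that $g(x)\in\{\ell_1(x),\ell_2(x)\}$ for all $x\in U$. BFGS method with Armijo--Wolfe line search applied to $g$: given $x_0$ and symmetric positive definite $H_0$, at iteration $k=0,1,2,\dots$ compute the search direction $p_k=-H_k\nabla g(x_k)$; choose (any) step size $\alpha_k>0$ such that $g$ is differentiable at $x_k+\alpha_kp_k$ and the Armijo--Wolfe conditions hold: $$g(x_k+\alpha_kp_k)\le g(x_k)+c_1\alpha_k\nabla g(x_k)^\top p_k,\qquad \nabla g(x_k+\alpha_kp_k)^\top p_k\ge c_2\nabla g(x_k)^\top p_k;$$ set $x_{k+1}=x_k+\alpha_kp_k$, $s_k=x_{k+1}-x_k$, $y_k=\nabla g(x_{k+1})-\nabla g(x_k)$, $\rho_k=(s_k^\top y_k)^{-1}$ and $$H_{k+1}=(I-\rho_ks_ky_k^\top)H_k(I-\rho_ky_ks_k^\top)+\rho_ks_ks_k^\top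 .$$ *)

theory Defs
  imports "HOL-Analysis.Analysis"
begin

definition affine_function :: "('a::real_inner \<Rightarrow> real) \<Rightarrow> bool" where
  "affine_function l \<longleftrightarrow> (\<exists>a b. \<forall>x. l x = a \<bullet> x + b)"

definition piecewise_linear :: "('a::euclidean_space \<Rightarrow> real) \<Rightarrow> bool" where
  "piecewise_linear g \<longleftrightarrow>
     (\<exists>\<P>. finite \<P> \<and> (\<forall>P\<in>\<P>. polyhedron P) \<and> \<Union>\<P> = UNIV \<and>
          (\<forall>P\<in>\<P>. \<exists>l. affine_function l \<and> (\<forall>x\<in>P. g x = l x)))"

definition only_two_pieces_intersect_at :: "('a::euclidean_space \<Rightarrow> real) \<Rightarrow> 'a \<Rightarrow> bool" where
  "only_two_pieces_intersect_at g z \<longleftrightarrow>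
     (\<exists>U l1 l2. open U \<and> z \<in> U \<and> affine_function l1 \<and> affine_function l2 \<and> l1 \<noteq> l2 \<and>
          (\<forall>x\<in>U. g x \<in> {l1 x, l2 x}))"

definition local_minimizer :: "('a::topological_space \<Rightarrow> real) \<Rightarrow> 'a \<Rightarrow> bool" where
  "local_minimizer g z \<longleftrightarrow> (\<forall>\<^sub>F x in nhds z. g z \<le> g x)"

text \<open>Unspecified where \<open>g\<close> is not differentiable.\<close>

definition gradient :: "('a::real_inner \<Rightarrow> real) \<Rightarrow> 'a \<Rightarrow> 'a" where
  "gradient g x = (THE D. GDERIV g x :> D)"

definition sym_pos_def :: "real^'n^'n \<Rightarrow> bool" where
  "sym_pos_def A \<longleftrightarrow> transpose A = A \<and> (\<forall>v. v \<noteq> 0 \<longrightarrow> v \<bullet> (A *v v) > 0)"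

text \<open>The rank-one matrix \<open>u v\<^sup>T\<close>.\<close>

definition outer :: "real^'n \<Rightarrow> real^'n \<Rightarrow> real^'n^'n" where
  "outer u v = (\<chi> i j. u $ i * v $ j)"

definition armijo_wolfe ::
  "real \<Rightarrow> real \<Rightarrow> (real^'n \<Rightarrow> real) \<Rightarrow> real^'n \<Rightarrow> real^'n \<Rightarrow> real \<Rightarrow> bool" where
  "armijo_wolfe c1 c2 g x p \<alpha> \<longleftrightarrow>
     \<alpha> > 0 \<and> g differentiable (at (x + \<alpha> *\<^sub>R p)) \<and>
     g (x + \<alpha> *\<^sub>R p) \<le> g x + c1 * \<alpha> * (gradient g x \<bullet> p) \<and>
     gradient g (x + \<alpha> *\<^sub>R p) \<bullet> p \<ge> c2 * (gradient g x \<bullet> p)"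

definition bfgs_update :: "real^'n^'n \<Rightarrow> real^'n \<Rightarrow> real^'n \<Rightarrow> real^'n^'n" where
  "bfgs_update H s y =
     (let \<rho> = inverse (s \<bullet> y) in
       (mat 1 - \<rho> *\<^sub>R outer s y) ** H ** (mat 1 - \<rho> *\<^sub>R outer y s) + \<rho> *\<^sub>R outer s s)"

text \<open>
  The sequences \<open>x\<close> and \<open>H\<close> are generated by some admissible choice of step sizes.
  The curvature \<open>s\<^sub>k \<bullet> y\<^sub>k\<close> is positive by the second line search condition whenever
  \<open>H\<^sub>k\<close> is positive definite, the gradient at \<open>x\<^sub>k\<close> is nonzero and \<open>c2 < 1\<close>. If that gradient
  vanishes, where the method would stop, the search direction is zero and \<open>x\<close> is constant from
  index \<open>k\<close> on.
\<close>

definition bfgs_generates ::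
  "real \<Rightarrow> real \<Rightarrow> (real^'n \<Rightarrow> real) \<Rightarrow> real^'n \<Rightarrow> real^'n^'n \<Rightarrow>
   (nat \<Rightarrow> real^'n) \<Rightarrow> (nat \<Rightarrow> real^'n^'n) \<Rightarrow> bool" where
  "bfgs_generates c1 c2 g x0 H0 x H \<longleftrightarrow>
     x 0 = x0 \<and> H 0 = H0 \<and>
     (\<forall>k. let p = - (H k *v gradient g (x k)) in
        (\<exists>\<alpha>. armijo_wolfe c1 c2 g (x k) p \<alpha> \<and> x (Suc k) = x k + \<alpha> *\<^sub>R p) \<and>
        H (Suc k) = bfgs_update (H k) (x (Suc k) - x k)
                      (gradient g (x (Suc k)) - gradient g (x k)))"

end

theory Submission
  imports Defs
begin

text \<open>
  Near \<open>xstar\<close> continuity leaves only \<open>g = max l1 l2\<close> or \<open>g = min l1 l2\<close>, since the alternatives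
  \<open>g = l1\<close> and \<open>g = l2\<close> are differentiable (\<open>two_pieces_max_or_min\<close>). The Wolfe condition makes
  \<open>s\<^sub>k \<bullet> y\<^sub>k > 0\<close>, so every \<open>H\<^sub>k\<close> is positive definite and consecutive gradients differ: from some
  index on they alternate between the slopes \<open>a1\<close> and \<open>a2\<close> of the two pieces. Positive curvature
  across the kink also excludes the concave function \<open>min l1 l2\<close>. If a positive combination of
  \<open>a1\<close> and \<open>a2\<close> vanishes, then \<open>xstar\<close> is a local minimizer of \<open>max l1 l2\<close>
  (\<open>local_minimizer_max_opposite_slopes\<close>). What remains is to refute convergence when no positive
  combination vanishes (\<open>bfgs_alternating_steps_bounded_below\<close>).

  There the dynamics reduce to the Gram matrix of the two slopes in the inner product \<open>H\<^sub>k\<close>. Let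
  \<open>a\<close> be the gradient at \<open>x\<^sub>k\<close> and \<open>b\<close> the other slope, and put \<open>c = a \<bullet> H a\<close>, \<open>d = b \<bullet> H b\<close>,
  \<open>q = - (a \<bullet> H b)\<close>, \<open>D = c d - q\<^sup>2\<close> and \<open>w = D / (c + q)\<close>.
  Curvature at the next step gives \<open>q > 0\<close>, and then \<open>D > 0\<close> by the strict Cauchy-Schwarz
  inequality. The BFGS formula shows that the step satisfies \<open>s \<bullet> b = \<alpha> q > w\<close>, that the next value
  of \<open>w\<close> is \<open>w (c / q)\<close>, and that two consecutive factors \<open>c / q\<close> have product at least \<open>1\<close>. So \<open>w\<close>
  does not decrease over two iterations, the steps stay bounded away from zero, and the iterates
  cannot converge.
\<close>

section \<open>The BFGS update as a change of inner product\<close>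

text \<open>
  Symmetric positive definiteness, phrased through the bilinear form: in this form it is read off
  directly from \<open>bfgs_update_form\<close>, without transposing the update.
\<close>

definition inner_product_matrix :: "real^'n^'n \<Rightarrow> bool" where
  "inner_product_matrix H \<longleftrightarrow>
     (\<forall>u v. u \<bullet> (H *v v) = v \<bullet> (H *v u)) \<and> (\<forall>v. v \<noteq> 0 \<longrightarrow> v \<bullet> (H *v v) > 0)"

lemma inner_product_matrix_sym_pos_def:
  assumes "sym_pos_def H" shows "inner_product_matrix H"
proof -
  have "u \<bullet> (H *v v) = v \<bullet> (H *v u)" for u v
    using assms by (metis sym_pos_def_def dot_lmul_matrix inner_commute transpose_matrix_vector)
  then show ?thesis using assms by (simp add: sym_pos_def_def inner_product_matrix_def)
qed

lemma outer_mult_vector: "outer u v *v z = (v \<bullet> z) *\<^sub>R u"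
  by (simp add: vec_eq_iff outer_def matrix_vector_mult_def inner_vec_def sum_distrib_left
      sum_distrib_right mult_ac)

text \<open>
  On the level of forms, BFGS projects both arguments along \<open>y\<close> onto the complement of \<open>s\<close>, and adds a
  rank-one term in the direction \<open>s\<close>. Both positive definiteness of the update and the explicit
  values below come from this one identity.
\<close>

lemma bfgs_update_form:
  assumes "\<rho> = inverse (s \<bullet> y)"
  shows "u \<bullet> (bfgs_update H s y *v v) =
     (u - (\<rho> * (u \<bullet> s)) *\<^sub>R y) \<bullet> (H *v (v - (\<rho> * (v \<bullet> s)) *\<^sub>R y)) + \<rho> * (u \<bullet> s) * (v \<bullet> s)"
proof -
  define w where "w = v - (\<rho> * (v \<bullet> s)) *\<^sub>R y"
  have w: "(mat 1 - \<rho> *\<^sub>R outer y s) *v v = w"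
    by (simp add: w_def matrix_vector_mult_diff_rdistrib outer_mult_vector inner_commute
        flip: scaleR_matrix_vector_assoc)
  have "bfgs_update H s y *v v =
      (mat 1 - \<rho> *\<^sub>R outer s y) *v (H *v w) + \<rho> *\<^sub>R ((s \<bullet> v) *\<^sub>R s)"
    by (simp add: bfgs_update_def Let_def assms[symmetric] matrix_vector_mult_add_rdistrib
        outer_mult_vector w flip: matrix_vector_mul_assoc scaleR_matrix_vector_assoc)
  also have "\<dots> = H *v w - (\<rho> * (y \<bullet> (H *v w))) *\<^sub>R s + (\<rho> * (s \<bullet> v)) *\<^sub>R s"
    by (simp add: matrix_vector_mult_diff_rdistrib outer_mult_vector
        flip: scaleR_matrix_vector_assoc)
  finally have Hv: "bfgs_update H s y *v v =
      H *v w - (\<rho> * (y \<bullet> (H *v w))) *\<^sub>R s + (\<rho> * (s \<bullet> v)) *\<^sub>R s" .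
  show ?thesis
    unfolding w_def[symmetric] Hv by (simp add: algebra_simps inner_commute)
qed

text \<open>
  The projection of \<open>v\<close> can vanish only if \<open>v\<close> is a multiple of \<open>y\<close>; then \<open>v \<bullet> s \<noteq> 0\<close> and the
  rank-one term is positive. This is why the cases split on \<open>v \<bullet> s = 0\<close>.
\<close>

lemma inner_product_matrix_bfgs_update:
  assumes H: "inner_product_matrix H" and sy: "s \<bullet> y > 0"
  shows "inner_product_matrix (bfgs_update H s y)"
proof -
  define \<rho> where "\<rho> = inverse (s \<bullet> y)"
  have \<rho>: "\<rho> > 0" using sy by (simp add: \<rho>_def)
  note form = bfgs_update_form[OF \<rho>_def, of _ H]
  have "u \<bullet> (bfgs_update H s y *v v) = v \<bullet> (bfgs_update H s y *v u)" for u v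
    unfolding form using H by (simp add: inner_product_matrix_def)
  moreover have "v \<bullet> (bfgs_update H s y *v v) > 0" if "v \<noteq> 0" for v
  proof (cases "v \<bullet> s = 0")
    case True
    then show ?thesis unfolding form using H that by (simp add: inner_product_matrix_def)
  next
    case False
    have "z \<bullet> (H *v z) \<ge> 0" for z
      using H by (cases "z = 0") (auto simp: inner_product_matrix_def less_imp_le)
    moreover have "\<rho> * (v \<bullet> s) * (v \<bullet> s) > 0"
      using False \<rho> by (simp add: mult.assoc flip: power2_eq_square)
    ultimately show ?thesis unfolding form by (simp add: add_nonneg_pos)
  qed
  ultimately show ?thesis by (simp add: inner_product_matrix_def)
qed

text \<open>
  For \<open>y = b - a\<close> the projection along \<open>y\<close> identifies \<open>a\<close> and \<open>b\<close>: both are sent to the same vector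
  \<open>(q a + c b) / (c + q)\<close>. Hence all three entries of the new Gram matrix contain the same number
  \<open>r\<close>, the square of its length in the inner product \<open>H\<close>, and differ only in the rank-one term.
\<close>

lemma bfgs_update_two_gradients:
  fixes a b :: "real^'n" and H :: "real^'n^'n" and \<alpha> :: real
  defines "s \<equiv> - \<alpha> *\<^sub>R (H *v a)"
  defines "H' \<equiv> bfgs_update H s (b - a)"
  defines "c \<equiv> a \<bullet> (H *v a)" and "d \<equiv> b \<bullet> (H *v b)" and "q \<equiv> - (a \<bullet> (H *v b))"
  assumes H: "inner_product_matrix H" and "\<alpha> > 0" and cq: "c + q > 0"
  defines "r \<equiv> c * (c * d - q\<^sup>2) / (c + q)\<^sup>2"
  shows "a \<bullet> (H' *v b) = r - \<alpha> * c * q / (c + q)"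
    and "b \<bullet> (H' *v b) = r + \<alpha> * q\<^sup>2 / (c + q)"
    and "a \<bullet> (H' *v a) = r + \<alpha> * c\<^sup>2 / (c + q)"
proof -
  have q': "b \<bullet> (H *v a) = - q" using H by (simp add: q_def inner_product_matrix_def)
  have as: "a \<bullet> s = - (\<alpha> * c)" and bs: "b \<bullet> s = \<alpha> * q" using q' by (simp_all add: s_def c_def)
  have sy: "s \<bullet> (b - a) = \<alpha> * (c + q)" using as bs by (simp add: inner_diff inner_commute algebra_simps)
  define \<rho> where "\<rho> = inverse (s \<bullet> (b - a))"
  have \<rho>: "\<rho> = 1 / (\<alpha> * (c + q))" by (simp add: \<rho>_def sy divide_simps)
  define e where "e = (1 / (c + q)) *\<^sub>R (q *\<^sub>R a + c *\<^sub>R b)"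
  have 1: "\<rho> * (a \<bullet> s) = - (c / (c + q))" "\<rho> * (b \<bullet> s) = q / (c + q)"
    using \<open>\<alpha> > 0\<close> cq by (simp_all add: as bs \<rho> divide_simps)
  have "q / (c + q) = 1 - c / (c + q)" using cq by (simp add: field_simps)
  moreover have "e = (q / (c + q)) *\<^sub>R a + (c / (c + q)) *\<^sub>R b"
    by (simp add: e_def scaleR_add_right)
  ultimately have e: "a - (\<rho> * (a \<bullet> s)) *\<^sub>R (b - a) = e" "b - (\<rho> * (b \<bullet> s)) *\<^sub>R (b - a) = e"
    unfolding 1 by (simp_all add: scaleR_diff_left scaleR_diff_right)
  have ab: "a \<bullet> (H *v b) = - q" by (simp add: q_def)
  have "e \<bullet> (H *v e) = (1 / (c + q))\<^sup>2 *
      (q\<^sup>2 * (a \<bullet> (H *v a)) + q * c * (a \<bullet> (H *v b)) + c * q * (b \<bullet> (H *v a)) + c\<^sup>2 * (b \<bullet> (H *v b)))"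
    unfolding e_def by (simp add: matrix_vector_mult_scaleR matrix_vector_right_distrib
        inner_add_left inner_add_right power2_eq_square distrib_left mult_ac)
  also have "\<dots> = (1 / (c + q))\<^sup>2 * (c * (c * d - q\<^sup>2))"
    unfolding q' ab c_def[symmetric] d_def[symmetric] by (simp add: power2_eq_square algebra_simps)
  also have "\<dots> = r" by (simp add: r_def power_divide)
  finally have r: "e \<bullet> (H *v e) = r" .
  note form = bfgs_update_form[OF \<rho>_def, of _ H _, folded H'_def]
  show "a \<bullet> (H' *v b) = r - \<alpha> * c * q / (c + q)"
    unfolding form unfolding e r unfolding 1 unfolding bs by simp
  show "b \<bullet> (H' *v b) = r + \<alpha> * q\<^sup>2 / (c + q)"
    unfolding form unfolding e r unfolding 1 unfolding bs by (simp add: power2_eq_square)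
  show "a \<bullet> (H' *v a) = r + \<alpha> * c\<^sup>2 / (c + q)"
    unfolding form unfolding e r unfolding 1 unfolding as by (simp add: power2_eq_square)
qed

section \<open>BFGS with two alternating gradients\<close>

text \<open>
  One BFGS step on the Gram matrix with entries \<open>c\<close>, \<open>d\<close> and \<open>- q\<close>. The primed entries are those of
  \<open>bfgs_update_two_gradients\<close> with the roles of the gradients exchanged, because the other slope is
  the current gradient after the step. The secant equation, tested with each slope,
  reads \<open>c' + q' = \<alpha> q\<close> and \<open>d' + q' = \<alpha> c\<close>; this makes the new determinant factor.
  The claims concern the potential \<open>D / (c + q)\<close>. When \<open>q' > 0\<close>, it bounds \<open>\<alpha> q\<close> from below, it is
  multiplied by \<open>c / q\<close> in each step, and the product of two consecutive factors is at least \<open>1\<close>.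
\<close>

lemma gram_determinant_step:
  fixes c d q \<alpha> :: real
  assumes "c > 0" "q > 0" "\<alpha> > 0" and D: "D = c * d - q\<^sup>2"
  defines "r \<equiv> c * D / (c + q)\<^sup>2"
  assumes c': "c' = r + \<alpha> * q\<^sup>2 / (c + q)" and d': "d' = r + \<alpha> * c\<^sup>2 / (c + q)"
    and q': "q' = \<alpha> * c * q / (c + q) - r"
  shows "(c' * d' - q'\<^sup>2) / (c' + q') = D / (c + q) * (c / q)"
    and "q' > 0 \<Longrightarrow> D / (c + q) < \<alpha> * q"
    and "q' > 0 \<Longrightarrow> D \<ge> 0 \<Longrightarrow> c / q * (c' / q') \<ge> 1"
proof -
  define t where "t = c + q"
  have t: "t > 0" "c = t - q" using assms(1,2) by (simp_all add: t_def)
  have cq: "c' + q' = \<alpha> * q" and dq: "d' + q' = \<alpha> * c"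
    unfolding c' d' q' t_def[symmetric] t(2) using t(1) by (simp_all add: field_simps power2_eq_square)
  have q'2: "q' * t = \<alpha> * c * q - c * D / t"
    unfolding q' r_def t_def[symmetric] using t(1) by (simp add: field_simps power2_eq_square)
  have "c' * d' - q'\<^sup>2 = (\<alpha> * q - q') * (\<alpha> * c - q') - q'\<^sup>2"
    unfolding cq[symmetric] dq[symmetric] by simp
  also have "\<dots> = \<alpha> * (\<alpha> * c * q - q' * t)"
    by (simp add: t_def power2_eq_square algebra_simps)
  also have "\<dots> = \<alpha> * c * D / (c + q)" unfolding q'2 by (simp add: t_def)
  finally have det: "c' * d' - q'\<^sup>2 = \<alpha> * c * D / (c + q)" .
  show "(c' * d' - q'\<^sup>2) / (c' + q') = D / (c + q) * (c / q)"
    unfolding det cq using assms(2,3) by simp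
  have "q' = c / t * (\<alpha> * q - D / t)"
    unfolding q' r_def t_def[symmetric] by (simp add: algebra_simps power2_eq_square)
  then show "D / (c + q) < \<alpha> * q" if "q' > 0"
    using that assms(1) t(1) zero_less_mult_pos[of "c / t" "\<alpha> * q - D / t"] by (simp add: t_def)
  show "c / q * (c' / q') \<ge> 1" if "q' > 0" "D \<ge> 0"
  proof -
    have "c * c' - q * q' = c * (c' + q') - q' * t" by (simp add: t_def algebra_simps)
    also have "\<dots> = c * D / t" unfolding cq q'2 by simp
    also have "\<dots> \<ge> 0" using assms(1) t(1) that by simp
    finally show ?thesis using assms(2) that by (simp add: field_simps)
  qed
qed

text \<open>The strict Cauchy-Schwarz inequality for the inner product given by \<open>H\<close>.\<close>

lemma gram_determinant_pos:
  assumes H: "inner_product_matrix H" and "b \<noteq> 0"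
    and ne: "(b \<bullet> (H *v b)) *\<^sub>R a - (a \<bullet> (H *v b)) *\<^sub>R b \<noteq> 0"
  shows "(a \<bullet> (H *v a)) * (b \<bullet> (H *v b)) - (a \<bullet> (H *v b))\<^sup>2 > 0"
proof -
  define d where "d = b \<bullet> (H *v b)"
  define p where "p = a \<bullet> (H *v b)"
  have d: "d > 0" using H \<open>b \<noteq> 0\<close> by (simp add: d_def inner_product_matrix_def)
  have p': "b \<bullet> (H *v a) = p" using H by (simp add: p_def inner_product_matrix_def)
  define v where "v = d *\<^sub>R a - p *\<^sub>R b"
  have "0 < v \<bullet> (H *v v)" using ne H by (simp add: v_def d_def p_def inner_product_matrix_def)
  also have "\<dots> = d\<^sup>2 * (a \<bullet> (H *v a)) - d * p * (a \<bullet> (H *v b)) - d * p * (b \<bullet> (H *v a))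
      + p\<^sup>2 * (b \<bullet> (H *v b))"
    unfolding v_def by (simp add: matrix_vector_mult_scaleR matrix_vector_mult_diff_distrib
        inner_diff_left inner_diff_right power2_eq_square algebra_simps)
  also have "\<dots> = d * ((a \<bullet> (H *v a)) * d - p\<^sup>2)"
    unfolding p' p_def[symmetric] d_def[symmetric] by (simp add: power2_eq_square algebra_simps)
  finally show ?thesis using d unfolding d_def[symmetric] p_def[symmetric]
    by (simp add: zero_less_mult_iff)
qed

text \<open>
  The obstruction to convergence. The potential \<open>w\<close> need not be monotone from one step to the next,
  but it does not decrease over two steps, so the smaller of its first two values bounds all of them
  from below.
\<close>

lemma bfgs_alternating_steps_bounded_below:
  fixes G s :: "nat \<Rightarrow> real^'n" and H :: "nat \<Rightarrow> real^'n^'n" and \<alpha> :: "nat \<Rightarrow> real"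
  assumes H: "\<And>k. inner_product_matrix (H k)"
    and \<alpha>: "\<And>k. \<alpha> k > 0"
    and s: "\<And>k. s k = - \<alpha> k *\<^sub>R (H k *v G k)"
    and update: "\<And>k. H (Suc k) = bfgs_update (H k) (s k) (G (Suc k) - G k)"
    and curvature: "\<And>k. s k \<bullet> (G (Suc k) - G k) > 0"
    and alternate: "\<And>k. G (Suc (Suc k)) = G k"
    and nz: "\<And>k. G k \<noteq> 0"
    and not_opposite: "\<And>k u v. u > 0 \<Longrightarrow> v > 0 \<Longrightarrow> u *\<^sub>R G k + v *\<^sub>R G (Suc k) \<noteq> 0"
  shows "\<exists>w>0. \<forall>k. s k \<bullet> G (Suc k) > w"
proof -
  define c where "c k = G k \<bullet> (H k *v G k)" for k
  define d where "d k = G (Suc k) \<bullet> (H k *v G (Suc k))" for k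
  define q where "q k = - (G k \<bullet> (H k *v G (Suc k)))" for k
  define D where "D k = c k * d k - (q k)\<^sup>2" for k
  define r where "r k = c k * D k / (c k + q k)\<^sup>2" for k
  define w where "w k = D k / (c k + q k)" for k
  have c: "c k > 0" and d: "d k > 0" for k
    using H nz by (auto simp: c_def d_def inner_product_matrix_def)
  have Gs: "s k \<bullet> G (Suc k) = \<alpha> k * q k" "s k \<bullet> G k = - \<alpha> k * c k" for k
    using H[of k] by (simp_all add: s q_def c_def inner_product_matrix_def inner_commute)
  have "\<alpha> k * (c k + q k) > 0" for k
    using curvature[of k] by (simp add: inner_diff_right Gs distrib_left)
  then have cq: "c k + q k > 0" for k using \<alpha> by (blast intro: zero_less_mult_pos)
  have step:
    "q (Suc k) = \<alpha> k * c k * q k / (c k + q k) - r k"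
    "c (Suc k) = r k + \<alpha> k * (q k)\<^sup>2 / (c k + q k)"
    "d (Suc k) = r k + \<alpha> k * (c k)\<^sup>2 / (c k + q k)" for k
  proof -
    note E = bfgs_update_two_gradients[OF H[of k] \<alpha>[of k], of "G k" "G (Suc k)",
      folded s, folded update, folded c_def d_def q_def, OF cq, folded D_def, folded r_def]
    have "G (Suc k) \<bullet> (H (Suc k) *v G k) = G k \<bullet> (H (Suc k) *v G (Suc k))"
      using H[of "Suc k"] by (simp add: inner_product_matrix_def)
    then show "q (Suc k) = \<alpha> k * c k * q k / (c k + q k) - r k"
      by (simp add: q_def[of "Suc k"] alternate E)
    show "c (Suc k) = r k + \<alpha> k * (q k)\<^sup>2 / (c k + q k)"
      by (fact E(2))
    show "d (Suc k) = r k + \<alpha> k * (c k)\<^sup>2 / (c k + q k)"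
      by (simp add: d_def[of "Suc k"] alternate E)
  qed
  \<comment> \<open>Curvature of the next step, where the gradient returns to \<open>G k\<close>, together with the secant
    equation.\<close>
  have q: "q k > 0" for k
  proof -
    have "c (Suc k) + q (Suc k) = \<alpha> k * (q k * (c k + q k)) / (c k + q k)"
      unfolding step by (simp add: power2_eq_square algebra_simps add_divide_distrib)
    also have "\<dots> = \<alpha> k * q k" using cq[of k] by (metis less_irrefl nonzero_mult_div_cancel_right mult.assoc)
    finally show ?thesis using cq[of "Suc k"] \<alpha> zero_less_mult_pos by metis
  qed
  have D: "D k > 0" for k
    using gram_determinant_pos[OF H nz, of "Suc k" k "G k"] not_opposite[OF d q, of k k]
    by (simp add: D_def c_def d_def q_def)
  note gds = gram_determinant_step[OF c q \<alpha> D_def step(2,3,1)[unfolded r_def]]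
  have below: "w k < s k \<bullet> G (Suc k)" for k
    using gds(2)[OF q] by (simp add: w_def Gs)
  have "w (Suc (Suc k)) \<ge> w k" for k
  proof -
    have w1: "w (Suc k) = w k * (c k / q k)" for k
      using gds(1) by (simp add: w_def D_def[of "Suc k"])
    have "w k > 0" using D[of k] cq[of k] by (simp add: w_def)
    moreover have "1 \<le> c k / q k * (c (Suc k) / q (Suc k))"
      using gds(3)[OF q] D[of k] by (simp add: less_imp_le)
    moreover have "w (Suc (Suc k)) = w k * (c k / q k * (c (Suc k) / q (Suc k)))"
      using w1 by simp
    ultimately show ?thesis by (metis mult_left_mono mult.right_neutral less_imp_le)
  qed
  then have "min (w 0) (w 1) \<le> w k \<and> min (w 0) (w 1) \<le> w (Suc k)" for k
    by (induction k) (auto intro: order_trans)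
  moreover have "min (w 0) (w 1) > 0" using D cq by (simp add: w_def)
  ultimately show ?thesis using below by (meson le_less_trans)
qed

section \<open>Functions with two affine pieces near a point\<close>

text \<open>
  Comparing \<open>g\<close> with an affine function that touches it at \<open>x\<close> from one side gives the gradient even
  if \<open>x\<close> is on the common boundary of two pieces. So the iterates need not be kept off the set where
  the pieces agree.
\<close>

lemma gradient_eq_touching_affine:
  assumes "g differentiable (at x)" and "open S" "x \<in> S" and eq: "g x = a \<bullet> x + b"
    and touch: "(\<forall>y\<in>S. g y \<le> a \<bullet> y + b) \<or> (\<forall>y\<in>S. a \<bullet> y + b \<le> g y)"
  shows "gradient g x = a"
proof -
  obtain g' where g': "(g has_derivative g') (at x)"
    using assms(1) by (auto simp: differentiable_def)
  have "((\<lambda>y. g y - (a \<bullet> y + b)) has_derivative (\<lambda>h. g' h - a \<bullet> h)) (at x)"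
    by (auto intro!: derivative_eq_intros g')
  moreover have "(\<forall>y\<in>S. g y - (a \<bullet> y + b) \<le> g x - (a \<bullet> x + b)) \<or>
      (\<forall>y\<in>S. g x - (a \<bullet> x + b) \<le> g y - (a \<bullet> y + b))"
    using touch eq by auto
  ultimately have "(\<lambda>h. g' h - a \<bullet> h) = (\<lambda>h. 0)"
    using differential_zero_maxmin assms(2,3) by blast
  then have "g' = (\<lambda>h. h \<bullet> a)" by (simp add: fun_eq_iff inner_commute)
  with g' have *: "GDERIV g x :> a" by (simp add: gderiv_def)
  have unique: "D = a" if "GDERIV g x :> D" for D
  proof -
    have "(\<lambda>h. h \<bullet> D) = (\<lambda>h. h \<bullet> a)"
      using has_derivative_unique that * unfolding gderiv_def by blast
    then have "\<forall>h. h \<bullet> D = h \<bullet> a" by (meson fun_cong)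
    then show ?thesis by (simp only: vector_eq_ldot)
  qed
  have "(THE D. GDERIV g x :> D) = a"
    using * unique by (rule the_equality)
  then show ?thesis by (simp only: gradient_def)
qed

text \<open>
  The quotient \<open>(g - l2) / (l1 - l2)\<close> is continuous and takes only the values \<open>0\<close> and \<open>1\<close>, so it is
  constant on a connected set.
\<close>

lemma single_piece_on_connected:
  fixes g l1 l2 :: "'a::topological_space \<Rightarrow> real"
  assumes "connected S" and "continuous_on S g" "continuous_on S l1" "continuous_on S l2"
    and "\<And>x. x \<in> S \<Longrightarrow> g x \<in> {l1 x, l2 x}" and "\<And>x. x \<in> S \<Longrightarrow> l1 x \<noteq> l2 x"
  shows "(\<forall>x\<in>S. g x = l1 x) \<or> (\<forall>x\<in>S. g x = l2 x)"
proof -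
  define \<phi> where "\<phi> x = (g x - l2 x) / (l1 x - l2 x)" for x
  have \<phi>: "g x = l1 x \<and> \<phi> x = 1 \<or> g x = l2 x \<and> \<phi> x = 0" if "x \<in> S" for x
    using assms(5,6)[OF that] by (auto simp: \<phi>_def)
  have "continuous_on S \<phi>"
    unfolding \<phi>_def using assms by (auto intro!: continuous_intros)
  moreover have "finite (\<phi> ` S)"
    by (rule finite_subset[of _ "{0, 1}"]) (use \<phi> in auto)
  ultimately have "\<phi> constant_on S"
    using continuous_finite_range_constant \<open>connected S\<close> by blast
  then obtain v where "\<forall>x\<in>S. \<phi> x = v" by (auto simp: constant_on_def)
  then show ?thesis using \<phi> by (metis zero_neq_one)
qed

lemma affine_function_differentiable:
  "affine_function l \<Longrightarrow> l differentiable (at x)"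
proof -
  assume "affine_function l"
  then obtain a b where "l = (\<lambda>x. a \<bullet> x + b)" unfolding affine_function_def by auto
  then show ?thesis by simp
qed

lemma affine_function_continuous_on: "affine_function l \<Longrightarrow> continuous_on S l"
  by (metis affine_function_differentiable continuous_at_imp_continuous_on
      differentiable_imp_continuous_within)

lemma differentiable_on_single_piece:
  assumes "affine_function l" "open S" "z \<in> S" "\<And>x. x \<in> S \<Longrightarrow> g x = l x"
  shows "g differentiable (at z)"
proof -
  obtain l' where "(l has_derivative l') (at z)"
    using affine_function_differentiable[OF assms(1)] by (auto simp: differentiable_def)
  then have "(g has_derivative l') (at z)"
    by (rule has_derivative_transform_within_open[OF _ assms(2,3)]) (simp add: assms(4))
  then show ?thesis by (auto simp: differentiable_def)
qed

text \<open>
  The hyperplane \<open>l1 = l2\<close> cuts a ball around \<open>z\<close> into two convex parts, each carrying a single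
  piece. The same piece on both sides would make \<open>g\<close> affine on the ball. The pieces agree at \<open>z\<close>
  because otherwise continuity would select one of them near \<open>z\<close>, again making \<open>g\<close> smooth there.
\<close>

lemma two_pieces_max_or_min:
  fixes g l1 l2 :: "'a::euclidean_space \<Rightarrow> real"
  assumes g: "continuous_on UNIV g" and U: "open U" "z \<in> U"
    and l: "affine_function l1" "affine_function l2"
    and two: "\<And>x. x \<in> U \<Longrightarrow> g x \<in> {l1 x, l2 x}"
    and kink: "\<not> g differentiable (at z)"
  obtains e where "e > 0" "l1 z = l2 z"
    "(\<forall>x\<in>ball z e. g x = max (l1 x) (l2 x)) \<or> (\<forall>x\<in>ball z e. g x = min (l1 x) (l2 x))"
proof -
  have smooth: "g differentiable (at z)"
    if "affine_function m1" "affine_function m2" "\<And>x. x \<in> U \<Longrightarrow> g x \<in> {m1 x, m2 x}"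
      "g z \<noteq> m2 z" for m1 m2
  proof (rule differentiable_on_single_piece[OF that(1)])
    show "open (U \<inter> {x. g x \<noteq> m2 x})"
      using U g affine_function_continuous_on[OF that(2)] by (intro open_Int open_Collect_neq)
  qed (use that U in auto)
  have "g z = l2 z" "g z = l1 z"
    using smooth[OF l] smooth[OF l(2) l(1)] two kink by blast+
  then have z: "l1 z = l2 z" by simp
  obtain e where e: "e > 0" "ball z e \<subseteq> U" using U open_contains_ball by blast
  have two': "g x \<in> {l1 x, l2 x}" if "x \<in> ball z e" for x using that two e(2) by blast
  obtain a1 b1 a2 b2 where ab: "l1 x = a1 \<bullet> x + b1" "l2 x = a2 \<bullet> x + b2" for x
    using l unfolding affine_function_def by auto
  define P where "P = ball z e \<inter> {x. l1 x > l2 x}"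
  define N where "N = ball z e \<inter> {x. l1 x < l2 x}"
  have "{x. l1 x > l2 x} = {x. (a1 - a2) \<bullet> x > b2 - b1}"
    "{x. l1 x < l2 x} = {x. (a1 - a2) \<bullet> x < b2 - b1}"
    unfolding ab by (auto simp: inner_diff_left)
  then have "convex P" "convex N"
    unfolding P_def N_def by (simp_all add: convex_Int convex_halfspace_gt convex_halfspace_lt)
  then have conn: "connected P" "connected N" by (simp_all add: convex_connected)
  have cont: "continuous_on S g" "continuous_on S l1" "continuous_on S l2" for S
    using g l by (auto intro: continuous_on_subset affine_function_continuous_on)
  have P: "(\<forall>x\<in>P. g x = l1 x) \<or> (\<forall>x\<in>P. g x = l2 x)"
    by (rule single_piece_on_connected[OF conn(1) cont]) (use two' in \<open>auto simp: P_def\<close>)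
  have N: "(\<forall>x\<in>N. g x = l1 x) \<or> (\<forall>x\<in>N. g x = l2 x)"
    by (rule single_piece_on_connected[OF conn(2) cont]) (use two' in \<open>auto simp: N_def\<close>)
  have cover: "x \<in> P \<or> x \<in> N \<or> g x = l1 x \<and> g x = l2 x" if "x \<in> ball z e" for x
    using two'[OF that] that by (auto simp: P_def N_def)
  have "\<exists>x\<in>ball z e. g x \<noteq> m x" if "affine_function m" for m
    using differentiable_on_single_piece[OF that, of "ball z e" z g] kink e(1) by fastforce
  then obtain x1 x2 where "x1 \<in> ball z e" "g x1 \<noteq> l1 x1" "x2 \<in> ball z e" "g x2 \<noteq> l2 x2"
    using l by meson
  with P N cover consider "\<forall>x\<in>P. g x = l1 x" "\<forall>x\<in>N. g x = l2 x"
    | "\<forall>x\<in>P. g x = l2 x" "\<forall>x\<in>N. g x = l1 x"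
    by metis
  then show ?thesis
  proof cases
    case 1
    then have "\<forall>x\<in>ball z e. g x = max (l1 x) (l2 x)"
      using cover by (fastforce simp: P_def N_def max_def)
    then show ?thesis using that e(1) z by blast
  next
    case 2
    then have "\<forall>x\<in>ball z e. g x = min (l1 x) (l2 x)"
      using cover by (fastforce simp: P_def N_def min_def)
    then show ?thesis using that e(1) z by blast
  qed
qed

text \<open>
  The hypothesis puts \<open>0\<close> in the convex hull of the slopes, that is, in the subdifferential of the
  convex function \<open>max l1 l2\<close> at \<open>z\<close>: no direction decreases both pieces.
\<close>

lemma local_minimizer_max_opposite_slopes:
  fixes g :: "'a::euclidean_space \<Rightarrow> real"
  assumes "e > 0" and g: "\<And>x. x \<in> ball z e \<Longrightarrow> g x = max (a1 \<bullet> x + b1) (a2 \<bullet> x + b2)"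
    and z: "a1 \<bullet> z + b1 = a2 \<bullet> z + b2" and uv: "u > 0" "v > 0" and "u *\<^sub>R a1 + v *\<^sub>R a2 = 0"
  shows "local_minimizer g z"
proof -
  have "g z \<le> g x" if x: "x \<in> ball z e" for x
  proof (rule ccontr)
    assume "\<not> g z \<le> g x"
    then have "a1 \<bullet> (x - z) < 0" "a2 \<bullet> (x - z) < 0"
      using g[OF x] g[of z] z \<open>e > 0\<close> by (auto simp: inner_diff_right)
    then have "u * (a1 \<bullet> (x - z)) + v * (a2 \<bullet> (x - z)) < 0"
      using uv by (intro add_neg_neg mult_pos_neg)
    also have "u * (a1 \<bullet> (x - z)) + v * (a2 \<bullet> (x - z)) = (u *\<^sub>R a1 + v *\<^sub>R a2) \<bullet> (x - z)"
      by (simp add: inner_add_left)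
    finally show False using assms by simp
  qed
  then show ?thesis
    unfolding local_minimizer_def eventually_nhds using \<open>e > 0\<close>
    by (meson centre_in_ball open_ball)
qed

section \<open>A limit of BFGS iterates on a simple kink\<close>

theorem mainTheorem3:
  fixes g :: "real^'n \<Rightarrow> real" and c1 c2 :: real
    and x0 xstar :: "real^'n" and H0 :: "real^'n^'n"
    and x :: "nat \<Rightarrow> real^'n" and H :: "nat \<Rightarrow> real^'n^'n"
  assumes "continuous_on UNIV g"
    and "piecewise_linear g"
    and "0 < c1" and "c1 < c2" and "c2 < 1"
    and "sym_pos_def H0"
    and "bfgs_generates c1 c2 g x0 H0 x H"
    and "\<And>k. g differentiable (at (x k))"
    and "x \<longlonglongrightarrow> xstar"
    and "\<not> g differentiable (at xstar)"
    and "only_two_pieces_intersect_at g xstar"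
  shows "local_minimizer g xstar"
proof (rule ccontr)
  assume not_min: "\<not> local_minimizer g xstar"
  define G where "G k = gradient g (x k)" for k
  define s where "s k = x (Suc k) - x k" for k
  have H_Suc: "H (Suc k) = bfgs_update (H k) (s k) (G (Suc k) - G k)" for k
    using assms(7) by (simp add: bfgs_generates_def Let_def s_def G_def)
  have "\<exists>\<alpha>>0. s k = - \<alpha> *\<^sub>R (H k *v G k) \<and>
      G (Suc k) \<bullet> (H k *v G k) \<le> c2 * (G k \<bullet> (H k *v G k))" for k
  proof -
    obtain \<alpha> where "armijo_wolfe c1 c2 g (x k) (- (H k *v G k)) \<alpha>"
      and x: "x (Suc k) = x k + \<alpha> *\<^sub>R (- (H k *v G k))"
      using assms(7) by (auto simp: bfgs_generates_def Let_def G_def)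
    then show ?thesis
      by (intro exI[of _ \<alpha>]) (simp add: armijo_wolfe_def s_def G_def flip: x)
  qed
  then obtain \<alpha> where \<alpha>: "\<alpha> k > 0" and s: "s k = - \<alpha> k *\<^sub>R (H k *v G k)"
    and wolfe: "G (Suc k) \<bullet> (H k *v G k) \<le> c2 * (G k \<bullet> (H k *v G k))" for k
    by metis
  \<comment> \<open>After a zero gradient the iterates are constant, so their limit would be the differentiability
    point \<open>x k\<close>.\<close>
  have nz: "G k \<noteq> 0" for k
  proof
    assume 0: "G k = 0"
    have "x (k + j) = x k" for j
    proof (induction j)
      case (Suc j)
      then have "G (k + j) = 0" using 0 by (simp add: G_def)
      then show ?case using Suc s[of "k + j"] by (simp add: s_def)
    qed simp
    then have "(\<lambda>j. x (j + k)) = (\<lambda>j. x k)" by (simp add: add.commute)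
    moreover have "(\<lambda>j. x (j + k)) \<longlonglongrightarrow> xstar" by (rule LIMSEQ_ignore_initial_segment) fact
    ultimately have "x k = xstar" by (simp add: LIMSEQ_const_iff)
    then show False using assms(8)[of k] assms(10) by simp
  qed
  have curvature: "s k \<bullet> (G (Suc k) - G k) > 0" if "inner_product_matrix (H k)" for k
  proof -
    have "G k \<bullet> (H k *v G k) > 0" using that nz by (simp add: inner_product_matrix_def)
    then have "c2 * (G k \<bullet> (H k *v G k)) < 1 * (G k \<bullet> (H k *v G k))"
      using \<open>c2 < 1\<close> by (intro mult_strict_right_mono)
    then have "\<alpha> k * (G k \<bullet> (H k *v G k) - G (Suc k) \<bullet> (H k *v G k)) > 0"
      using wolfe[of k] \<alpha> by simp
    also have "\<alpha> k * (G k \<bullet> (H k *v G k) - G (Suc k) \<bullet> (H k *v G k)) = s k \<bullet> (G (Suc k) - G k)"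
      by (simp add: s inner_diff_right inner_diff_left inner_commute algebra_simps)
    finally show ?thesis .
  qed
  have ipm: "inner_product_matrix (H k)" for k
  proof (induction k)
    case 0
    then show ?case using assms(6,7) inner_product_matrix_sym_pos_def
      by (simp add: bfgs_generates_def)
  next
    case (Suc k)
    show ?case unfolding H_Suc by (rule inner_product_matrix_bfgs_update[OF Suc curvature[OF Suc]])
  qed
  note curvature = curvature[OF ipm]

  obtain U l1 l2 where U: "open U" "xstar \<in> U" "affine_function l1" "affine_function l2"
    "\<And>x. x \<in> U \<Longrightarrow> g x \<in> {l1 x, l2 x}"
    using assms(11) unfolding only_two_pieces_intersect_at_def by auto
  obtain e where e: "e > 0" "l1 xstar = l2 xstar"
    "(\<forall>x\<in>ball xstar e. g x = max (l1 x) (l2 x)) \<or> (\<forall>x\<in>ball xstar e. g x = min (l1 x) (l2 x))"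
    using two_pieces_max_or_min[OF assms(1) U assms(10)] .
  obtain a1 b1 a2 b2 where l: "l1 x = a1 \<bullet> x + b1" "l2 x = a2 \<bullet> x + b2" for x
    using U unfolding affine_function_def by auto
  obtain K where K: "\<And>k. k \<ge> K \<Longrightarrow> x k \<in> ball xstar e"
    using assms(9) \<open>e > 0\<close> by (metis LIMSEQ_iff_nz dist_commute mem_ball metric_LIMSEQ_D)

  note touching = gradient_eq_touching_affine[OF assms(8) open_ball[of xstar e] K, folded G_def]
  have slope1: "G k = a1" if "k \<ge> K" "g (x k) = l1 (x k)"
      "(\<forall>y\<in>ball xstar e. g y \<le> l1 y) \<or> (\<forall>y\<in>ball xstar e. l1 y \<le> g y)" for k
    using touching[of k a1 b1] that by (simp flip: l)
  have slope2: "G k = a2" if "k \<ge> K" "g (x k) = l2 (x k)"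
      "(\<forall>y\<in>ball xstar e. g y \<le> l2 y) \<or> (\<forall>y\<in>ball xstar e. l2 y \<le> g y)" for k
    using touching[of k a2 b2] that by (simp flip: l)
  have max: "\<forall>x\<in>ball xstar e. g x = max (l1 x) (l2 x)"
  proof (rule ccontr)
    assume "\<not> ?thesis"
    then have min: "g y = min (l1 y) (l2 y)" if "y \<in> ball xstar e" for y using e(3) that by blast
    have G: "l1 (x k) \<le> l2 (x k) \<and> G k = a1 \<or> l2 (x k) \<le> l1 (x k) \<and> G k = a2" if "k \<ge> K" for k
    proof (cases "l1 (x k) \<le> l2 (x k)")
      case True
      then have "G k = a1" using K[OF that] that min by (intro slope1 slope2) auto
      then show ?thesis using True by simp
    next
      case False
      then have "G k = a2" using K[OF that] that min by (intro slope1 slope2) auto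
      then show ?thesis using False by simp
    qed
    \<comment> \<open>The directional slope of a concave function does not increase along the step, which
      contradicts positive curvature.\<close>
    have "s K \<bullet> (a2 - a1) = (l2 (x (Suc K)) - l1 (x (Suc K))) - (l2 (x K) - l1 (x K))"
      by (simp add: s_def l inner_diff_left inner_diff_right inner_commute)
    moreover have "s K \<bullet> (a1 - a2) = - (s K \<bullet> (a2 - a1))" by (simp add: inner_diff_right)
    ultimately show False using curvature[of K] G[of K] G[of "Suc K"] by auto
  qed
  have G: "G k = a1 \<or> G k = a2" if "k \<ge> K" for k
  proof (cases "l1 (x k) \<ge> l2 (x k)")
    case True
    then have "G k = a1" using K[OF that] that max by (intro slope1 slope2) auto
    then show ?thesis by simp
  next
    case False
    then have "G k = a2" using K[OF that] that max by (intro slope1 slope2) auto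
    then show ?thesis by simp
  qed
  have switch: "G (Suc k) \<noteq> G k" for k using curvature[of k] by auto
  have not_opposite: "u *\<^sub>R a1 + v *\<^sub>R a2 \<noteq> 0" if "u > 0" "v > 0" for u v
    using local_minimizer_max_opposite_slopes[OF \<open>e > 0\<close>, of xstar g a1 b1 a2 b2 u v] that max e(2)
      not_min by (auto simp: l)

  have "\<exists>w>0. \<forall>k. s (k + K) \<bullet> G (Suc k + K) > w"
  proof (rule bfgs_alternating_steps_bounded_below[where H = "\<lambda>k. H (k + K)" and \<alpha> = "\<lambda>k. \<alpha> (k + K)"])
    show "G (Suc (Suc k) + K) = G (k + K)" for k
      using G[of "k + K"] G[of "Suc k + K"] G[of "Suc (Suc k) + K"] switch[of "k + K"]
        switch[of "Suc k + K"] by auto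
    show "u *\<^sub>R G (k + K) + v *\<^sub>R G (Suc k + K) \<noteq> 0" if "u > 0" "v > 0" for k u v
      using G[of "k + K"] G[of "Suc k + K"] switch[of "k + K"] not_opposite[OF that]
        not_opposite[OF that(2,1)] by (auto simp: add.commute)
  qed (use ipm \<alpha> s H_Suc curvature nz in auto)
  then obtain w where w: "w > 0" "s (k + K) \<bullet> G (Suc k + K) > w" for k by blast
  have "(\<lambda>k. x (Suc k)) \<longlonglongrightarrow> xstar" using assms(9) by (rule LIMSEQ_Suc)
  then have "s \<longlonglongrightarrow> 0" unfolding s_def using assms(9) tendsto_diff by fastforce
  then have "(\<lambda>k. norm (s k) * (norm a1 + norm a2)) \<longlonglongrightarrow> 0"
    by (intro tendsto_mult_left_zero tendsto_norm_zero)
  then have "(\<lambda>k. norm (s (k + K)) * (norm a1 + norm a2)) \<longlonglongrightarrow> 0"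
    by (rule LIMSEQ_ignore_initial_segment)
  then obtain k where k: "norm (s (k + K)) * (norm a1 + norm a2) < w"
    using order_tendstoD(2)[of _ 0 sequentially w] w(1) eventually_happens' by fastforce
  have "norm (G (Suc k + K)) \<le> norm a1 + norm a2" using G[of "Suc k + K"] by auto
  then have "s (k + K) \<bullet> G (Suc k + K) \<le> norm (s (k + K)) * (norm a1 + norm a2)"
    by (meson mult_left_mono norm_cauchy_schwarz norm_ge_zero order_trans)
  then show False using k w(2)[of k] by simp
qed

end
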